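(* Let $G=\mathrm{GL}(4|1)$ over $\mathbb{C}$, fix $j\in\{i,-i\}$, and let $\xi$ be the conjugation $g\mapsto g^\xi=L(g^\theta)^{-1}L$ of $G$ defined in the context. Then $\xi$ induces on $\mathrm{Lie}(G)$ the conjugation $$\begin{pmatrix} X & \mu \\ \nu & x \end{pmatrix}\longmapsto\begin{pmatrix} -FX^\dagger F & -jF\nu^\dagger \\ -j\mu^\dagger F & -\bar x \end{pmatrix},$$ which for $j=-i$ coincides with the conjugation $$\sigma:\begin{pmatrix} X & \mu \\ \nu & x \end{pmatrix}\longmapsto\begin{pmatrix} -FX^\dagger F & iF\nu^\dagger \\ i\mu^\dagger F & -\bar x \end{pmatrix}.$$
   Context: For a complex ringed superspace $R$, $G(R)$ is the group of invertible even matrices $g=\begin{pmatrix} D & \tau \\ \rho & d \end{pmatrix}$ with entries in the superalgebra $\mathcal{O}(R)$, where $D$ is $4\times4$ and $d$ is $1\times1$ with even entries, $\tau$ is $4\times1$ and $\rho$ is $1\times4$ with odd entries. $\bar G$ is the complex conjugate supermanifold of $G$ (the supermanifold with a $\mathbb{C}$-antilinear isomorphism of sheaves of superalgebras $\mathcal{O}_G\to\mathcal{O}_{\bar G}$, $f\mapsto\bar f$); for odd $\theta,\eta$ the convention is $\overline{\theta\eta}=\bar\theta\,\bar\eta$. Define $G(R)\to\bar G(R)$ by $$g=\begin{pmatrix} D & \tau \\ \rho & d \end{pmatrix}\mapsto g^\theta=\begin{pmatrix} D^\dagger & j\rho^\dagger \\ j\tau^\dagger & \bar d \end{pmatrix},$$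 with $\dagger$ the transpose of the entrywise conjugate, and $$g^\xi:=L(g^\theta)^{-1}L,\qquad L=\begin{pmatrix} F & 0 \\ 0 & 1 \end{pmatrix},\quad F=\begin{pmatrix} 0 & I_2 \\ I_2 & 0 \end{pmatrix}.$$ $\mathrm{Lie}(G)$ is the space of matrices $\begin{pmatrix} X & \mu \\ \nu & x \end{pmatrix}$ with $X$ $4\times4$, $\mu$ $4\times1$, $\nu$ $1\times4$, $x$ a scalar. The induced map on $\mathrm{Lie}(G)$ is the tangent map at the identity, computed by applying $\xi$ to $\mathrm{id}+\varepsilon\begin{pmatrix} X & \mu \\ \nu & x \end{pmatrix}$ to first order in $\varepsilon$. (In the paper $\sigma$ is defined on $\mathfrak{sl}(4|1)$; it is given by the same formula.) *)

theory Defs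
  imports "HOL-Analysis.Analysis"
begin

text \<open>Supercommutative superalgebras over the complex numbers: the possible rings \<open>O(R)\<close> of
  functions on a (nonempty) complex ringed superspace \<open>R\<close>.\<close>

class superalgebra = ring_1 +
  fixes scaleC :: "complex \<Rightarrow> 'a \<Rightarrow> 'a" (infixr "*\<^sub>C" 75)
    and evens :: "'a set"
    and odds :: "'a set"
  assumes scaleC_add_right: "c *\<^sub>C (a + b) = c *\<^sub>C a + c *\<^sub>C b"
    and scaleC_add_left: "(c + c') *\<^sub>C a = c *\<^sub>C a + c' *\<^sub>C a"
    and scaleC_scaleC: "c *\<^sub>C (c' *\<^sub>C a) = (c * c') *\<^sub>C a"
    and scaleC_one: "1 *\<^sub>C a = a"
    and mult_scaleC_left: "(c *\<^sub>C a) * b = c *\<^sub>C (a * b)"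
    and mult_scaleC_right: "a * (c *\<^sub>C b) = c *\<^sub>C (a * b)"
    and evens_add: "a \<in> evens \<Longrightarrow> b \<in> evens \<Longrightarrow> a + b \<in> evens"
    and odds_add: "a \<in> odds \<Longrightarrow> b \<in> odds \<Longrightarrow> a + b \<in> odds"
    and evens_scaleC: "a \<in> evens \<Longrightarrow> c *\<^sub>C a \<in> evens"
    and odds_scaleC: "a \<in> odds \<Longrightarrow> c *\<^sub>C a \<in> odds"
    and evens_plus_odds: "\<exists>b\<in>evens. \<exists>c\<in>odds. a = b + c"
    and evens_Int_odds: "evens \<inter> odds = {0}"
    and one_even: "1 \<in> evens"
    and even_even: "a \<in> evens \<Longrightarrow> b \<in> evens \<Longrightarrow> a * b \<in> evens"
    and even_odd: "a \<in> evens \<Longrightarrow> b \<in> odds \<Longrightarrow> a * b \<in> odds"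
    and odd_odd: "a \<in> odds \<Longrightarrow> b \<in> odds \<Longrightarrow> a * b \<in> evens"
    and even_commute: "a \<in> evens \<Longrightarrow> a * b = b * a"
    and odd_anticommute: "a \<in> odds \<Longrightarrow> b \<in> odds \<Longrightarrow> a * b = - (b * a)"

text \<open>\<open>bar\<close> exhibits \<open>'b\<close> as the complex conjugate of the superalgebra \<open>'a\<close>.  The convention
  \<open>bar (\<theta> * \<eta>) = bar \<theta> * bar \<eta>\<close> (no reordering) applies to odd elements too.\<close>

definition conjugate_superalgebra :: "('a::superalgebra \<Rightarrow> 'b::superalgebra) \<Rightarrow> bool" where
  "conjugate_superalgebra bar \<longleftrightarrow> bij bar \<and> bar 1 = 1 \<and>
     (\<forall>a b. bar (a + b) = bar a + bar b) \<and>
     (\<forall>a b. bar (a * b) = bar a * bar b) \<and>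
     (\<forall>c a. bar (c *\<^sub>C a) = cnj c *\<^sub>C bar a) \<and>
     bar ` evens = evens \<and> bar ` odds = odds"


text \<open>Block matrices are indexed by disjoint sums of index types.  A \<open>4 \<times> 4\<close> block is indexed
  by \<open>2 + 2\<close>, so that \<open>F\<close> can be written with its \<open>2 \<times> 2\<close> blocks.\<close>

type_synonym four = "2 + 2"
type_synonym 'a smat = "'a ^ (four + 1) ^ (four + 1)"

definition block ::
  "'a ^ 'n::finite ^ 'm::finite \<Rightarrow> 'a ^ 'p::finite ^ 'm \<Rightarrow> 'a ^ 'n ^ 'q::finite \<Rightarrow> 'a ^ 'p ^ 'q
    \<Rightarrow> 'a ^ ('n + 'p) ^ ('m + 'q)" where
  "block A B C D = (\<chi> r s. case r of
      Inl i \<Rightarrow> (case s of Inl k \<Rightarrow> A $ i $ k | Inr l \<Rightarrow> B $ i $ l)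
    | Inr i \<Rightarrow> (case s of Inl k \<Rightarrow> C $ i $ k | Inr l \<Rightarrow> D $ i $ l))"

definition UL :: "'a ^ ('n::finite + 'p::finite) ^ ('m::finite + 'q::finite) \<Rightarrow> 'a ^ 'n ^ 'm" where
  "UL M = (\<chi> i k. M $ Inl i $ Inl k)"
definition UR :: "'a ^ ('n::finite + 'p::finite) ^ ('m::finite + 'q::finite) \<Rightarrow> 'a ^ 'p ^ 'm" where
  "UR M = (\<chi> i k. M $ Inl i $ Inr k)"
definition LL :: "'a ^ ('n::finite + 'p::finite) ^ ('m::finite + 'q::finite) \<Rightarrow> 'a ^ 'n ^ 'q" where
  "LL M = (\<chi> i k. M $ Inr i $ Inl k)"
definition LR :: "'a ^ ('n::finite + 'p::finite) ^ ('m::finite + 'q::finite) \<Rightarrow> 'a ^ 'p ^ 'q" where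
  "LR M = (\<chi> i k. M $ Inr i $ Inr k)"

definition dagger :: "('a \<Rightarrow> 'b) \<Rightarrow> 'a ^ 'n::finite ^ 'm::finite \<Rightarrow> 'b ^ 'm ^ 'n" where
  "dagger bar M = transpose (map_matrix bar M)"

definition F :: "'a::ring_1 ^ four ^ four" where
  "F = block 0 (mat 1) (mat 1) 0"

definition L :: "'a::ring_1 smat" where
  "L = block F 0 0 (mat 1)"


definition even_matrix :: "'a::superalgebra smat \<Rightarrow> bool" where
  "even_matrix g \<longleftrightarrow>
     (\<forall>i k. UL g $ i $ k \<in> evens) \<and> (\<forall>i k. UR g $ i $ k \<in> odds) \<and>
     (\<forall>i k. LL g $ i $ k \<in> odds) \<and> (\<forall>i k. LR g $ i $ k \<in> evens)"

text \<open>\<open>G(R)\<close> with \<open>O(R) = 'a\<close>.\<close>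

definition GL41 :: "'a::superalgebra smat set" where
  "GL41 = {g. even_matrix g \<and> invertible g}"

text \<open>A point of the conjugate supergroup over \<open>R\<close> is a point of \<open>G\<close> over the conjugate of
  \<open>O(R)\<close>; hence the following maps take matrices over \<open>'a\<close> to matrices over its conjugate \<open>'b\<close>.\<close>

definition theta :: "('a::superalgebra \<Rightarrow> 'b::superalgebra) \<Rightarrow> complex \<Rightarrow> 'a smat \<Rightarrow> 'b smat" where
  "theta bar j g =
     block (dagger bar (UL g)) (map_matrix ((*\<^sub>C) j) (dagger bar (LL g)))
           (map_matrix ((*\<^sub>C) j) (dagger bar (UR g))) (map_matrix bar (LR g))"

definition xi :: "('a::superalgebra \<Rightarrow> 'b::superalgebra) \<Rightarrow> complex \<Rightarrow> 'a smat \<Rightarrow> 'b smat" where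
  "xi bar j g = L ** matrix_inv (theta bar j g) ** L"


lemma sum_UNIV_plus: "sum f (UNIV :: ('a::finite + 'b::finite) set) =
   (\<Sum>i\<in>UNIV. f (Inl i)) + (\<Sum>k\<in>UNIV. f (Inr k) :: 'c::comm_monoid_add)"
  by (simp add: sum.Plus flip: UNIV_Plus_UNIV)

lemma block_mult:
  "block A B C D ** block A' B' C' D' =
   block (A ** A' + B ** C') (A ** B' + B ** D') (C ** A' + D ** C') (C ** B' + D ** D')"
  by (auto simp: vec_eq_iff matrix_matrix_mult_def block_def sum_UNIV_plus split: sum.split)

lemma mat_1_block: "mat 1 = block (mat 1) 0 0 (mat 1)"
  by (auto simp: vec_eq_iff mat_def block_def split: sum.split)

lemma matrix_zero [simp]: "A ** (0 :: 'a::semiring_1 ^ 'p ^ 'n) = 0" "(0 :: 'a::semiring_1 ^ 'p ^ 'n) ** B = 0"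
  by (simp_all add: vec_eq_iff matrix_matrix_mult_def)

lemma F_F: "F ** F = mat 1"
  by (simp add: F_def block_mult mat_1_block)

lemma L_L: "L ** L = mat 1"
  by (simp add: L_def block_mult F_F mat_1_block[where ?'a = 'a and ?'b = four and ?'c=1])

text \<open>The homogeneous part of a given parity: \<open>gr True\<close> is the even part.\<close>

definition gr :: "bool \<Rightarrow> 'a::superalgebra set" where "gr p = (if p then evens else odds)"

lemma scaleC_0 [simp]: "0 *\<^sub>C a = 0" "c *\<^sub>C (0::'a::superalgebra) = 0"
  by (metis add_cancel_left_left scaleC_add_left, metis add_cancel_left_left scaleC_add_right)
lemma scaleC_neg1: "(-1) *\<^sub>C a = - a"
  by (metis add.right_inverse add_eq_0_iff scaleC_0(1) scaleC_add_left scaleC_one)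

lemma zero_gr: "0 \<in> gr p" using evens_Int_odds unfolding gr_def by auto
lemma zero_eo [simp]: "0 \<in> evens" "0 \<in> odds" using evens_Int_odds by auto
lemma add_gr: "a \<in> gr p \<Longrightarrow> b \<in> gr p \<Longrightarrow> a + b \<in> gr p"
  by (auto simp: gr_def evens_add odds_add)
lemma uminus_gr: "a \<in> gr p \<Longrightarrow> - a \<in> gr p"
  unfolding gr_def by (metis scaleC_neg1 evens_scaleC odds_scaleC)
lemma diff_gr: "a \<in> gr p \<Longrightarrow> b \<in> gr p \<Longrightarrow> a - b \<in> gr p"
  using add_gr[of a p "-b"] uminus_gr[of b p] by simp
lemma sum_gr: "(\<And>k. k \<in> K \<Longrightarrow> f k \<in> gr p) \<Longrightarrow> sum f K \<in> gr p"
  by (induction K rule: infinite_finite_induct) (auto simp: zero_gr add_gr)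
lemma mult_gr: "a \<in> gr p \<Longrightarrow> b \<in> gr q \<Longrightarrow> a * b \<in> gr (p = q)"
  using even_even[of a b] even_odd[of a b] odd_odd[of a b] even_odd[of b a] even_commute[of b a]
  by (auto simp: gr_def split: if_splits)
lemma gr_split: "\<exists>b c. b \<in> gr p \<and> c \<in> gr (\<not>p) \<and> a = b + c"
  using evens_plus_odds[of a] by (auto simp: gr_def add.commute)
lemma gr_disj: "a \<in> gr p \<Longrightarrow> a \<in> gr (\<not>p) \<Longrightarrow> a = 0"
  using evens_Int_odds by (auto simp: gr_def split: if_splits)

lemma even_matrix_iff: "even_matrix g \<longleftrightarrow> (\<forall>r s. g $ r $ s \<in> gr (isl r = isl s))"
proof -
  have all: "(\<forall>r :: four + 1. P r) \<longleftrightarrow> (\<forall>i. P (Inl i)) \<and> (\<forall>i. P (Inr i))" for P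
    by (metis sum.exhaust)
  show ?thesis
    unfolding even_matrix_def UL_def UR_def LL_def LR_def all
    by (simp only: gr_def vec_lambda_beta sum.disc simp_thms if_True if_False) blast
qed

lemma theta_nth: "theta bar j g $ r $ s = (if isl r = isl s then bar (g$s$r) else j *\<^sub>C bar (g$s$r))"
  by (auto simp: theta_def block_def UL_def UR_def LL_def LR_def dagger_def transpose_def split: sum.split)

lemma matrix_mult_nth: "(A ** B) $ r $ s = (\<Sum>k\<in>UNIV. A$r$k * B$k$s)"
  by (simp add: matrix_matrix_mult_def)

lemma even_matrix_mult: "even_matrix g \<Longrightarrow> even_matrix h \<Longrightarrow> even_matrix (g ** h)"
  unfolding even_matrix_iff matrix_mult_nth
proof (intro allI sum_gr)
  fix r s k assume "\<forall>r s. g $ r $ s \<in> gr (isl r = isl s)" "\<forall>r s. h $ r $ s \<in> gr (isl r = isl s)"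
  then have "g $ r $ k * h $ k $ s \<in> gr ((isl r = isl k) = (isl k = isl s))"
    by (intro mult_gr) auto
  moreover have "((isl r = isl k) = (isl k = isl s)) = (isl r = isl s)" by auto
  ultimately show "g $ r $ k * h $ k $ s \<in> gr (isl r = isl s)" by simp
qed

lemma even_matrix_1: "even_matrix (mat 1)"
  using one_even by (auto simp: even_matrix_iff mat_def gr_def)

lemma F_nth: "F $ r $ s \<in> {0, 1}"
  by (auto simp: F_def block_def mat_def split: sum.split)

lemma F_sym: "F $ r $ s = F $ s $ r"
  by (auto simp: F_def block_def mat_def split: sum.split)

lemma L_nth: "(L :: 'a::ring_1 smat) $ r $ s \<in> {0, 1} \<and> (isl r \<noteq> isl s \<longrightarrow> (L :: 'a smat) $ r $ s = 0)"
  using F_nth[where ?'a='a] by (auto simp: L_def block_def mat_def split: sum.split)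

lemma L_sym: "L $ r $ s = L $ s $ r"
  by (auto simp: L_def block_def mat_def F_sym split: sum.split)

lemma even_matrix_L: "even_matrix L"
  unfolding even_matrix_iff
proof (intro allI)
  fix r s :: "four + 1"
  show "(L :: 'a smat) $ r $ s \<in> gr (isl r = isl s)"
    using one_even[where ?'a='a] L_nth[of r s, where ?'a='a] zero_neq_one[where ?'a='a]
    by (cases "isl r = isl s") (auto simp: gr_def)
qed

lemma matrix_inverse_unique:
  fixes A :: "'a::semiring_1 ^ 'n ^ 'n"
  assumes "B ** A = mat 1" "A ** C = mat 1" shows "B = C"
proof -
  have "B = B ** (A ** C)" by (simp add: assms)
  also have "\<dots> = C" by (simp add: matrix_mul_assoc assms(1))
  finally show ?thesis .
qed

lemma matrix_inv_eqI:
  fixes A :: "'a::semiring_1 ^ 'n ^ 'n"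
  assumes "A ** B = mat 1" "B ** A = mat 1" shows "matrix_inv A = B"
  unfolding matrix_inv_def
proof (rule some_equality)
  show "C = B" if "A ** C = mat 1 \<and> C ** A = mat 1" for C
    using that assms matrix_inverse_unique[of C A B] by simp
qed (simp add: assms)

lemma matrix_add_rdistrib': "((A::'a::semiring_1 ^ 'n ^ 'm) + B) ** C = A ** C + B ** C"
  by (simp add: vec_eq_iff matrix_matrix_mult_def sum.distrib distrib_right)

lemma even_inverse:
  fixes g h :: "'a::superalgebra smat"
  assumes g: "even_matrix g" and h: "g ** h = mat 1" "h ** g = mat 1"
  shows "even_matrix h"
proof -
  have "\<forall>r s. \<exists>b c. b \<in> gr (isl r = isl s) \<and> c \<in> gr (isl r \<noteq> isl s) \<and> h $ r $ s = b + c"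
    using gr_split by blast
  then obtain B C where BC: "\<And>r s. B r s \<in> gr (isl r = isl s)"
    "\<And>r s. C r s \<in> gr (isl r \<noteq> isl s)" "\<And>r s. h $ r $ s = B r s + C r s"
    by metis
  define h0 h1 where "h0 = (\<chi> r s. B r s)" and "h1 = (\<chi> r s. C r s)"
  have h01: "h = h0 + h1" by (simp add: h0_def h1_def vec_eq_iff BC)
  have e0: "even_matrix h0" by (simp add: h0_def even_matrix_iff BC)
  have e2: "even_matrix (g ** h0)" using even_matrix_mult g e0 .
  have eq: "g ** h0 + g ** h1 = mat 1" using h h01 by (simp add: matrix_add_ldistrib)
  have "g ** h1 = 0"
    unfolding vec_eq_iff zero_index
  proof (intro allI)
    fix r s
    have "(g ** h1) $ r $ s = (mat 1 :: 'a smat) $ r $ s - (g ** h0) $ r $ s"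
      using eq by (metis add_diff_cancel_left' vector_minus_component)
    moreover have "\<dots> \<in> gr (isl r = isl s)"
      using e2 even_matrix_1 unfolding even_matrix_iff by (intro diff_gr) auto
    ultimately have A: "(g ** h1) $ r $ s \<in> gr (isl r = isl s)" by simp
    have "(g ** h1) $ r $ s \<in> gr (\<not> (isl r = isl s))"
      unfolding matrix_mult_nth
    proof (rule sum_gr)
      fix k
      have "g $ r $ k * h1 $ k $ s \<in> gr ((isl r = isl k) = (isl k \<noteq> isl s))"
        using g BC(2)[of k s] unfolding even_matrix_iff by (intro mult_gr) (auto simp: h1_def)
      moreover have "((isl r = isl k) = (isl k \<noteq> isl s)) = (\<not> (isl r = isl s))" by auto
      ultimately show "g $ r $ k * h1 $ k $ s \<in> gr (\<not> (isl r = isl s))" by simp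
    qed
    with A show "(g ** h1) $ r $ s = 0" by (rule gr_disj)
  qed
  then have "h ** (g ** h1) = 0" by simp
  then have "h1 = 0" by (simp add: matrix_mul_assoc h)
  with h01 e0 show ?thesis by simp
qed

lemma GL41_cases:
  assumes "g \<in> GL41"
  obtains h where "h \<in> GL41" "g ** h = mat 1" "h ** g = mat 1"
  using assms even_inverse unfolding GL41_def invertible_def by blast

lemma GL41_I: "even_matrix g \<Longrightarrow> g ** h = mat 1 \<Longrightarrow> h ** g = mat 1 \<Longrightarrow> g \<in> GL41"
  unfolding GL41_def invertible_def by blast

lemma GL41_mult: "g \<in> GL41 \<Longrightarrow> h \<in> GL41 \<Longrightarrow> g ** h \<in> GL41"
proof -
  assume g: "g \<in> GL41" and h: "h \<in> GL41"
  obtain g' where g': "g ** g' = mat 1" "g' ** g = mat 1" by (rule GL41_cases[OF g])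
  obtain h' where h': "h ** h' = mat 1" "h' ** h = mat 1" by (rule GL41_cases[OF h])
  have "(g ** h) ** (h' ** g') = g ** (h ** h') ** g'" "(h' ** g') ** (g ** h) = h' ** (g' ** g) ** h"
    by (simp_all only: matrix_mul_assoc)
  then have "(g ** h) ** (h' ** g') = mat 1" "(h' ** g') ** (g ** h) = mat 1"
    by (simp_all add: g' h')
  moreover have "even_matrix (g ** h)"
    using g h by (simp add: GL41_def even_matrix_mult)
  ultimately show ?thesis by (intro GL41_I)
qed

lemma L_GL41: "L \<in> GL41" using GL41_I[OF even_matrix_L L_L L_L] .

context
  fixes bar :: "'a::superalgebra \<Rightarrow> 'b::superalgebra" and j :: complex
  assumes bar: "conjugate_superalgebra bar" and j: "j \<in> {\<i>, - \<i>}"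
begin

lemma bar_simps: "bar 1 = 1" "bar (a + b) = bar a + bar b" "bar (a * b) = bar a * bar b"
   "bar (c *\<^sub>C a) = cnj c *\<^sub>C bar a" "bar 0 = 0"
  using bar unfolding conjugate_superalgebra_def
  by simp_all (metis (no_types, lifting) add_cancel_left_left)

lemma bar_sum: "bar (sum f K) = (\<Sum>k\<in>K. bar (f k))"
  by (induction K rule: infinite_finite_induct) (auto simp: bar_simps)

lemma bar_gr: "a \<in> gr p \<Longrightarrow> bar a \<in> gr p"
  using bar unfolding conjugate_superalgebra_def gr_def by (auto split: if_splits)

lemma even_theta: "even_matrix g \<Longrightarrow> even_matrix (theta bar j g)"
  unfolding even_matrix_iff theta_nth
  by (auto simp: bar_gr odds_scaleC gr_def) 
     (metis (full_types) bar_gr gr_def odds_scaleC)+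

lemma theta_mult:
  assumes "even_matrix g" "even_matrix h"
  shows "theta bar j (g ** h) = theta bar j h ** theta bar j g"
  unfolding vec_eq_iff
proof (intro allI)
  fix r s
  let ?c = "\<lambda>r s :: four + 1. if isl r = isl s then 1 else j"
  have th: "theta bar j g $ r $ s = ?c r s *\<^sub>C bar (g$s$r)" for g r s
    by (simp add: theta_nth scaleC_one)
  have jj: "j * j = -1" using j by auto
  have "?c r s *\<^sub>C (bar (g$s$k) * bar (h$k$r)) =
    (?c r k *\<^sub>C bar (h$k$r)) * (?c k s *\<^sub>C bar (g$s$k))" for k
  proof -
    have G: "bar (g$s$k) \<in> gr (isl s = isl k)" and H: "bar (h$k$r) \<in> gr (isl k = isl r)"
      using assms bar_gr unfolding even_matrix_iff by auto
    show ?thesis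
    proof (cases "isl s = isl k \<or> isl k = isl r")
      case True
      then have "bar (g$s$k) * bar (h$k$r) = bar (h$k$r) * bar (g$s$k)"
        using G H even_commute[of "bar (g$s$k)"] even_commute[of "bar (h$k$r)"]
        by (auto simp: gr_def)
      then show ?thesis using True
        by (auto simp: scaleC_one mult_scaleC_left mult_scaleC_right)
    next
      case False
      then have "bar (g$s$k) * bar (h$k$r) = - (bar (h$k$r) * bar (g$s$k))"
        using G H odd_anticommute by (auto simp: gr_def)
      moreover have "isl r = isl s" using False by auto
      moreover have "(j *\<^sub>C bar (h$k$r)) * (j *\<^sub>C bar (g$s$k)) = - (bar (h$k$r) * bar (g$s$k))"
        by (simp only: mult_scaleC_left mult_scaleC_right scaleC_scaleC jj scaleC_neg1)
      moreover have "isl r \<noteq> isl k" "isl k \<noteq> isl s" using False by auto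
      ultimately show ?thesis
        by (simp only: if_True if_False scaleC_one simp_thms)
    qed
  qed
  moreover have "c *\<^sub>C sum f K = (\<Sum>k\<in>K. c *\<^sub>C f k :: 'b)" for c f and K :: "(four+1) set"
    by (induction K rule: infinite_finite_induct) (auto simp: scaleC_add_right)
  ultimately show "theta bar j (g ** h) $ r $ s = (theta bar j h ** theta bar j g) $ r $ s"
    by (simp only: th matrix_mult_nth bar_sum bar_simps)
qed

lemma theta_1: "theta bar j (mat 1) = mat 1"
  by (auto simp: vec_eq_iff theta_nth mat_def bar_simps)

lemma theta_L: "theta bar j L = L"
proof -
  have "bar (L $ s $ r) = L $ r $ s" for r s
    using L_sym[of r s, where ?'a='a] L_sym[of r s, where ?'a='b]
    apply (cases r; cases s) 
    by (auto simp: L_def block_def mat_def bar_simps F_def split: sum.split)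
  moreover have "isl r \<noteq> isl s \<Longrightarrow> (L::'b smat) $ r $ s = 0" for r s using L_nth[of r s, where ?'a='b] by simp
  ultimately show ?thesis by (auto simp: vec_eq_iff theta_nth)
qed

lemma theta_theta: "theta (inv bar) j (theta bar j g) = g"
proof -
  have inv_bar: "inv bar (bar a) = a" for a
    using bar unfolding conjugate_superalgebra_def bij_def by simp
  have jj: "cnj j * j = 1" "j * cnj j = 1" using j by auto
  have "inv bar (j *\<^sub>C bar a) = cnj j *\<^sub>C a" for a
    by (metis bar_simps(4) complex_cnj_cnj inv_bar)
  then show ?thesis
    by (auto simp: vec_eq_iff theta_nth inv_bar scaleC_scaleC jj scaleC_one)
qed

lemma xi_eq:
  assumes "g \<in> GL41" "g ** h = mat 1" "h ** g = mat 1"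
  shows "xi bar j g = L ** theta bar j h ** L" and "xi bar j g \<in> GL41"
    and "theta bar j g ** theta bar j h = mat 1" "theta bar j h ** theta bar j g = mat 1"
proof -
  have e: "even_matrix g" "even_matrix h"
    using assms even_inverse[of g h] unfolding GL41_def by auto
  show t: "theta bar j g ** theta bar j h = mat 1" "theta bar j h ** theta bar j g = mat 1"
    using theta_mult[OF e(2,1)] theta_mult[OF e] by (simp_all add: assms theta_1)
  show x: "xi bar j g = L ** theta bar j h ** L"
    using matrix_inv_eqI[OF t] by (simp add: xi_def)
  show "xi bar j g \<in> GL41"
    unfolding x using GL41_I[OF even_theta[OF e(2)] t(2,1)] L_GL41 by (intro GL41_mult)
qed

lemma conj_inv: "conjugate_superalgebra (inv bar)"
proof -
  have b: "bij bar" using bar unfolding conjugate_superalgebra_def by blast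
  then have i: "inv bar (bar a) = a" "bar (inv bar c) = c" for a c
    by (auto simp: bij_is_inj bij_is_surj surj_f_inv_f)
  have im: "bar ` evens = evens" "bar ` odds = odds" 
    using bar unfolding conjugate_superalgebra_def by blast+
  show ?thesis
    unfolding conjugate_superalgebra_def
    apply (intro conjI allI)
    subgoal using b by (rule bij_imp_bij_inv)
    subgoal by (metis i(1) bar_simps(1))
    subgoal by (metis i bar_simps(2))
    subgoal by (metis i bar_simps(3))
    subgoal by (metis i bar_simps(4) complex_cnj_cnj)
    subgoal using image_inv_f_f[OF bij_is_inj[OF b], of evens] im by simp
    subgoal using image_inv_f_f[OF bij_is_inj[OF b], of odds] im by simp
    done
qed

end

text \<open>\<open>\<xi>\<close> is a conjugation of \<open>G\<close>: an involutive morphism of groups from \<open>G\<close> to the conjugate of \<open>G\<close>.\<close>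

theorem xi_conjugation:
  assumes "conjugate_superalgebra bar" "j \<in> {\<i>, - \<i>}" "g \<in> GL41" "h \<in> GL41"
  shows "xi bar j g \<in> GL41"
    and "xi bar j (g ** h) = xi bar j g ** xi bar j h"
    and "xi (inv bar) j (xi bar j g) = g"
proof -
  obtain g' where g': "g' \<in> GL41" "g ** g' = mat 1" "g' ** g = mat 1" by (rule GL41_cases[OF assms(3)])
  obtain h' where h': "h' \<in> GL41" "h ** h' = mat 1" "h' ** h = mat 1" by (rule GL41_cases[OF assms(4)])
  note X = xi_eq[OF assms(1,2)]
  note e = assms(3,4)[unfolded GL41_def mem_Collect_eq] g'(1)[unfolded GL41_def mem_Collect_eq] h'(1)[unfolded GL41_def mem_Collect_eq]
  have LLA: "L ** (L ** A) = A" for A :: "'b smat"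
    by (simp add: L_L matrix_mul_assoc)
  have LLA': "L ** (L ** A) = A" for A :: "'a smat"
    by (simp add: L_L matrix_mul_assoc)
  show x: "xi bar j g \<in> GL41" using X(2) assms(3) g' by blast
  have gh: "(g ** h) ** (h' ** g') = mat 1" "(h' ** g') ** (g ** h) = mat 1"
  proof -
    have "(g ** h) ** (h' ** g') = g ** (h ** h') ** g'" "(h' ** g') ** (g ** h) = h' ** (g' ** g) ** h"
      by (simp_all add: matrix_mul_assoc)
    then show "(g ** h) ** (h' ** g') = mat 1" "(h' ** g') ** (g ** h) = mat 1"
      using g' h' by simp_all
  qed
  show "xi bar j (g ** h) = xi bar j g ** xi bar j h"
    unfolding X(1)[OF assms(3) g'(2,3)] X(1)[OF assms(4) h'(2,3)]
      X(1)[OF GL41_mult[OF assms(3,4)] gh]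
    using e by (simp add: theta_mult[OF assms(1,2)] LLA flip: matrix_mul_assoc)
  let ?y = "L ** theta bar j g ** L"
  have xy: "xi bar j g ** ?y = mat 1" "?y ** xi bar j g = mat 1"
    unfolding X(1)[OF assms(3) g'(2,3)]
  proof -
    have T: "theta bar j g' ** (theta bar j g ** A) = A" "theta bar j g ** (theta bar j g' ** A) = A" for A
      using X(3,4)[OF assms(3) g'(2,3)] by (simp_all add: matrix_mul_assoc)
    show "L ** theta bar j g' ** L ** ?y = mat 1" "?y ** (L ** theta bar j g' ** L) = mat 1"
      by (simp_all add: LLA T L_L flip: matrix_mul_assoc)
  qed
  note iv = conj_inv[OF assms(1,2)]
  have E: "even_matrix (theta bar j g)" using even_theta[OF assms(1,2)] e by blast
  have "xi (inv bar) j (xi bar j g) = L ** theta (inv bar) j ?y ** L"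
    by (rule xi_eq(1)[OF iv assms(2) x xy])
  also have "theta (inv bar) j ?y = L ** g ** L"
    unfolding theta_mult[OF iv assms(2) even_matrix_mult[OF even_matrix_L E] even_matrix_L]
      theta_mult[OF iv assms(2) even_matrix_L E] theta_L[OF iv assms(2)] theta_theta[OF assms(1,2)]
    by (simp add: matrix_mul_assoc)
  finally show "xi (inv bar) j (xi bar j g) = g"
    by (simp add: LLA' L_L flip: matrix_mul_assoc)
qed


text \<open>Super dual numbers: \<open>SDual a b c\<close> is \<open>a + b \<epsilon>\<^sub>0 + c \<epsilon>\<^sub>1\<close> with \<open>\<epsilon>\<^sub>0\<close> even, \<open>\<epsilon>\<^sub>1\<close> odd, and all
  products of the \<open>\<epsilon>\<^sub>i\<close> equal to zero.\<close>

datatype sdual = SDual (body: complex) (eps0: complex) (eps1: complex)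

instantiation sdual :: superalgebra
begin

definition "0 = SDual 0 0 0"
definition "1 = SDual 1 0 0"
definition "u + v = SDual (body u + body v) (eps0 u + eps0 v) (eps1 u + eps1 v)"
definition "u - v = SDual (body u - body v) (eps0 u - eps0 v) (eps1 u - eps1 v)"
definition "- u = SDual (- body u) (- eps0 u) (- eps1 u)"
definition "u * v = SDual (body u * body v) (body u * eps0 v + eps0 u * body v)
                          (body u * eps1 v + eps1 u * body v)"
definition "c *\<^sub>C u = SDual (c * body u) (c * eps0 u) (c * eps1 u)"
definition "evens = {u. eps1 u = 0}"
definition "odds = {u. body u = 0 \<and> eps0 u = 0}"

lemmas sdual_defs = zero_sdual_def one_sdual_def plus_sdual_def minus_sdual_def
  uminus_sdual_def times_sdual_def scaleC_sdual_def evens_sdual_def odds_sdual_def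

instance
proof
  fix a :: sdual
  have "a = SDual (body a) (eps0 a) 0 + SDual 0 0 (eps1 a)"
    by (simp add: sdual_defs)
  then show "\<exists>b\<in>evens. \<exists>c\<in>odds. a = b + c"
    unfolding evens_sdual_def odds_sdual_def by force
  show "evens \<inter> odds = {0::sdual}"
    by (auto simp: sdual_defs intro: sdual.expand)
qed (auto simp: sdual_defs algebra_simps)

end

definition cnj_sdual :: "sdual \<Rightarrow> sdual" where
  "cnj_sdual u = SDual (cnj (body u)) (cnj (eps0 u)) (cnj (eps1 u))"

lemma conjugate_superalgebra_sdual: "conjugate_superalgebra cnj_sdual"
proof -
  have inv: "cnj_sdual (cnj_sdual u) = u" for u
    by (simp add: cnj_sdual_def)
  have sub: "cnj_sdual ` evens \<subseteq> evens" "cnj_sdual ` odds \<subseteq> odds"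
    by (auto simp: sdual_defs cnj_sdual_def)
  have "cnj_sdual ` evens = evens" "cnj_sdual ` odds = odds"
    using sub by (metis (no_types, lifting) equalityI image_eqI image_subset_iff inv subsetI)+
  moreover have "bij cnj_sdual"
    using inv by (rule involuntory_imp_bij)
  ultimately show ?thesis
    by (auto simp: conjugate_superalgebra_def sdual_defs cnj_sdual_def)
qed

text \<open>\<open>Lie(G)\<close> is the space \<open>complex smat\<close>.  Its matrices have complex entries in all four blocks, so
  for \<open>id + \<epsilon> Y\<close> to be an even matrix, \<open>\<epsilon>\<close> must be even on the diagonal blocks and odd on the
  off-diagonal ones.\<close>

definition eps :: "complex smat \<Rightarrow> sdual smat" where
  "eps Y = block (map_matrix (\<lambda>c. SDual 0 c 0) (UL Y)) (map_matrix (\<lambda>c. SDual 0 0 c) (UR Y))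
                 (map_matrix (\<lambda>c. SDual 0 0 c) (LL Y)) (map_matrix (\<lambda>c. SDual 0 c 0) (LR Y))"

lemma eps_nth: "eps Y $ r $ s = (if isl r = isl s then SDual 0 (Y $ r $ s) 0 else SDual 0 0 (Y $ r $ s))"
  by (auto simp: eps_def block_def UL_def UR_def LL_def LR_def split: sum.split)

lemma eps_mult_eps: "eps Y ** eps Z = 0"
  by (simp add: vec_eq_iff matrix_mult_nth eps_nth sdual_defs sum.neutral flip: zero_sdual_def)

lemma id_plus_eps_GL41: "mat 1 + eps Y \<in> GL41"
proof (rule GL41_I)
  show "even_matrix (mat 1 + eps Y)"
    by (auto simp: even_matrix_iff eps_nth mat_def gr_def sdual_defs)
  have d: "A ** (B - C) = A ** B - A ** C" "(B - C) ** A = B ** A - C ** A" for A B C :: "sdual smat"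
    by (simp_all add: vec_eq_iff matrix_mult_nth algebra_simps sum_subtractf)
  show "(mat 1 + eps Y) ** (mat 1 - eps Y) = mat 1" "(mat 1 - eps Y) ** (mat 1 + eps Y) = mat 1"
    by (simp_all add: d matrix_add_ldistrib matrix_add_rdistrib' eps_mult_eps)
qed

text \<open>The tangent map at the identity of \<open>f\<close> is \<open>\<phi>\<close>; this determines \<open>\<phi>\<close>, as \<open>eps\<close> is injective.\<close>

definition induces_on_Lie :: "(sdual smat \<Rightarrow> sdual smat) \<Rightarrow> (complex smat \<Rightarrow> complex smat) \<Rightarrow> bool" where
  "induces_on_Lie f \<phi> \<longleftrightarrow> (\<forall>Y. f (mat 1 + eps Y) = mat 1 + eps (\<phi> Y))"

definition Lie_even :: "complex smat \<Rightarrow> complex smat" where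
  "Lie_even Y = block (UL Y) 0 0 (LR Y)"
definition Lie_odd :: "complex smat \<Rightarrow> complex smat" where
  "Lie_odd Y = block 0 (UR Y) (LL Y) 0"

text \<open>The bilinear extension of \<open>Y ** Z - (-1) ^ (|Y| |Z|) Z ** Y\<close>.\<close>

definition superbracket :: "complex smat \<Rightarrow> complex smat \<Rightarrow> complex smat" where
  "superbracket Y Z = Y ** Z - (Lie_even Z ** Y + Lie_odd Z ** Lie_even Y - Lie_odd Z ** Lie_odd Y)"

definition Lie_conjugation :: "(complex smat \<Rightarrow> complex smat) \<Rightarrow> bool" where
  "Lie_conjugation \<phi> \<longleftrightarrow>
     (\<forall>Y Z. \<phi> (Y + Z) = \<phi> Y + \<phi> Z) \<and>
     (\<forall>c Y. \<phi> (map_matrix ((*) c) Y) = map_matrix ((*) (cnj c)) (\<phi> Y)) \<and>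
     (\<forall>Y. \<phi> (Lie_even Y) = Lie_even (\<phi> Y)) \<and>
     (\<forall>Y. \<phi> (Lie_odd Y) = Lie_odd (\<phi> Y)) \<and>
     (\<forall>Y Z. \<phi> (superbracket Y Z) = superbracket (\<phi> Y) (\<phi> Z)) \<and>
     (\<forall>Y. \<phi> (\<phi> Y) = Y)"

definition xi_Lie :: "complex \<Rightarrow> complex smat \<Rightarrow> complex smat" where
  "xi_Lie j Y =
     block (- (F ** dagger cnj (UL Y) ** F)) (map_matrix ((*) (- j)) (F ** dagger cnj (LL Y)))
           (map_matrix ((*) (- j)) (dagger cnj (UR Y) ** F)) (- map_matrix cnj (LR Y))"

definition sigma_conj :: "complex smat \<Rightarrow> complex smat" where
  "sigma_conj Y =
     block (- (F ** dagger cnj (UL Y) ** F)) (map_matrix ((*) \<i>) (F ** dagger cnj (LL Y)))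
           (map_matrix ((*) \<i>) (dagger cnj (UR Y) ** F)) (- map_matrix cnj (LR Y))"

lemma UL_block [simp]: "UL (block A B C D) = A" and UR_block [simp]: "UR (block A B C D) = B"
  and LL_block [simp]: "LL (block A B C D) = C" and LR_block [simp]: "LR (block A B C D) = D"
  by (simp_all add: vec_eq_iff block_def UL_def UR_def LL_def LR_def)

lemma xi_Lie_block: "xi_Lie j (block X \<mu> \<nu> x) =
    block (- (F ** dagger cnj X ** F)) (map_matrix ((*) (- j)) (F ** dagger cnj \<nu>))
          (map_matrix ((*) (- j)) (dagger cnj \<mu> ** F)) (- map_matrix cnj x)"
  by (simp add: xi_Lie_def)

lemma sigma_conj_block: "sigma_conj (block X \<mu> \<nu> x) =
    block (- (F ** dagger cnj X ** F)) (map_matrix ((*) \<i>) (F ** dagger cnj \<nu>))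
          (map_matrix ((*) \<i>) (dagger cnj \<mu> ** F)) (- map_matrix cnj x)"
  by (simp add: sigma_conj_def)

end

theory Submission
  imports Defs
begin

text \<open>Conjugation by \<open>L\<close> permutes rows and columns by the involution \<open>swap_L\<close>.  Hence the entry
  of \<open>xi_Lie j Y\<close> at \<open>(r, s)\<close> is \<open>- c\<^sub>r\<^sub>s * cnj (Y $ swap_L s $ swap_L r)\<close>, where the weight \<open>c\<^sub>r\<^sub>s\<close> is
  \<open>1\<close> on the diagonal blocks and \<open>j\<close> on the off-diagonal ones.  The relation
  \<open>c\<^sub>r\<^sub>k * c\<^sub>k\<^sub>s = \<plusminus> c\<^sub>r\<^sub>s\<close>, with the minus sign exactly when both positions are odd (as \<open>j * j = - 1\<close>),
  absorbs the sign of the superbracket.  The tangent map is read off from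
  \<open>(1 + \<epsilon> Y)\<^sup>-\<^sup>1 = 1 - \<epsilon> Y\<close>, since \<open>\<theta>\<close> is affine in \<open>\<epsilon>\<close>.\<close>

definition swap_F :: "four \<Rightarrow> four" where
  "swap_F = case_sum Inr Inl"

definition swap_L :: "four + 1 \<Rightarrow> four + 1" where
  "swap_L = map_sum swap_F id"

lemma swap_F_swap_F [simp]: "swap_F (swap_F i) = i"
  by (auto simp: swap_F_def split: sum.split)

lemma swap_L_simps [simp]: "swap_L (Inl i) = Inl (swap_F i)" "swap_L (Inr k) = Inr k"
  by (simp_all add: swap_L_def)

lemma swap_L_swap_L [simp]: "swap_L (swap_L r) = r"
  by (cases r) simp_all

lemma swap_L_eq_iff [simp]: "swap_L r = swap_L s \<longleftrightarrow> r = s"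
  by (metis swap_L_swap_L)

lemma isl_swap_L [simp]: "isl (swap_L r) = isl r"
  by (cases r) simp_all

lemma sum_swap_L: "(\<Sum>k\<in>UNIV. f (swap_L k)) = (\<Sum>k\<in>UNIV. f k)"
  by (rule sum.reindex_bij_witness[of _ swap_L swap_L]) simp_all

lemma F_nth_swap: "F $ r $ k = (if k = swap_F r then 1 else 0)" "F $ k $ s = (if k = swap_F s then 1 else 0)"
  by (auto simp: F_def block_def mat_def swap_F_def split: sum.split)

lemma L_nth_swap: "L $ r $ k = (if k = swap_L r then 1 else 0)" "L $ k $ s = (if k = swap_L s then 1 else 0)"
  by (auto simp: L_def block_def mat_def F_nth_swap(1) split: sum.split)

lemma F_mult_nth: "(F ** A) $ r $ s = A $ swap_F r $ s"
  and mult_F_nth: "(B ** F) $ r' $ s' = B $ r' $ swap_F s'"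
  by (simp_all add: matrix_matrix_mult_def F_nth_swap(1)[of r] F_nth_swap(2)[of _ s']
      if_distrib if_distribR cong: if_cong)

lemma L_mult_nth: "(L ** A) $ r $ s = A $ swap_L r $ s"
  and mult_L_nth: "(B ** L) $ r' $ s' = B $ r' $ swap_L s'"
  by (simp_all add: matrix_matrix_mult_def L_nth_swap(1)[of r] L_nth_swap(2)[of _ s']
      if_distrib if_distribR cong: if_cong)

lemma xi_Lie_nth:
  "xi_Lie j Y $ r $ s = - (if isl r = isl s then 1 else j) * cnj (Y $ swap_L s $ swap_L r)"
  \<comment> \<open>\<open>xi_Lie\<close> conjugates the lower right block without transposing it;
    this agrees with the transposed formula because the index type \<open>1\<close> has a single
    element.\<close>
  by (cases r; cases s)
    (simp_all add: xi_Lie_def block_def F_mult_nth mult_F_nth dagger_def transpose_def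
      UL_def UR_def LL_def LR_def, metis num1_eq_iff)

lemma Lie_even_nth: "Lie_even Y $ r $ s = (if isl r = isl s then Y $ r $ s else 0)"
  and Lie_odd_nth: "Lie_odd Y $ r $ s = (if isl r = isl s then 0 else Y $ r $ s)"
  by (auto simp: Lie_even_def Lie_odd_def block_def UL_def UR_def LL_def LR_def split: sum.split)

text \<open>Splitting by parity leaves one product \<open>Z $ r $ k * Y $ k $ s\<close> for each
  \<open>k\<close>, its sign reversed exactly when both entries are odd.\<close>

lemma superbracket_nth:
  "superbracket Y Z $ r $ s = (\<Sum>k\<in>UNIV. Y $ r $ k * Z $ k $ s
     - (if isl r \<noteq> isl k \<and> isl k \<noteq> isl s then - 1 else 1) * (Z $ r $ k * Y $ k $ s))"
  unfolding superbracket_def matrix_mult_nth vector_minus_component vector_add_component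
    Lie_even_nth Lie_odd_nth sum.distrib[symmetric] sum_subtractf[symmetric]
proof (rule sum.cong)
  fix k
  show "Y $ r $ k * Z $ k $ s - ((if isl r = isl k then Z $ r $ k else 0) * Y $ k $ s
      + (if isl r = isl k then 0 else Z $ r $ k) * (if isl k = isl s then Y $ k $ s else 0)
      - (if isl r = isl k then 0 else Z $ r $ k) * (if isl k = isl s then 0 else Y $ k $ s)) =
    Y $ r $ k * Z $ k $ s
      - (if isl r \<noteq> isl k \<and> isl k \<noteq> isl s then - 1 else 1) * (Z $ r $ k * Y $ k $ s)"
    by (cases "isl r"; cases "isl k"; cases "isl s") simp_all
qed simp

lemma xi_Lie_superbracket:
  assumes "j * j = - 1"
  shows "xi_Lie j (superbracket Y Z) = superbracket (xi_Lie j Y) (xi_Lie j Z)"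
  unfolding vec_eq_iff
proof (intro allI)
  fix r s :: "four + 1"
  let ?c = "\<lambda>r s :: four + 1. if isl r = isl s then 1 else j"
  let ?e = "\<lambda>k. if isl r \<noteq> isl k \<and> isl k \<noteq> isl s then - 1 else 1 :: complex"
  have c: "?c r k * ?c k s = ?e k * ?c r s" for k
    using assms by (cases "isl r"; cases "isl k"; cases "isl s") simp_all
  have "superbracket Y Z $ swap_L s $ swap_L r =
      (\<Sum>k\<in>UNIV. Y $ swap_L s $ swap_L k * Z $ swap_L k $ swap_L r
        - ?e k * (Z $ swap_L s $ swap_L k * Y $ swap_L k $ swap_L r))"
    unfolding superbracket_nth
      sum_swap_L[of "\<lambda>k. Y $ swap_L s $ k * Z $ k $ swap_L r
        - (if isl s \<noteq> isl k \<and> isl k \<noteq> isl r then - 1 else 1) * (Z $ swap_L s $ k * Y $ k $ swap_L r)",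
        symmetric] isl_swap_L
    \<comment> \<open>The parity sign is symmetric in \<open>r\<close> and \<open>s\<close>.\<close>
    by (simp only: eq_commute conj_commute)
  then have "xi_Lie j (superbracket Y Z) $ r $ s =
      - ?c r s * (\<Sum>k\<in>UNIV. cnj (Y $ swap_L s $ swap_L k) * cnj (Z $ swap_L k $ swap_L r)
        - ?e k * (cnj (Z $ swap_L s $ swap_L k) * cnj (Y $ swap_L k $ swap_L r)))"
    by (simp only: xi_Lie_nth cnj_sum complex_cnj_diff complex_cnj_mult if_distrib[of cnj]
        complex_cnj_minus complex_cnj_one)
  also have "\<dots> = superbracket (xi_Lie j Y) (xi_Lie j Z) $ r $ s"
    unfolding superbracket_nth xi_Lie_nth sum_distrib_left
  proof (rule sum.cong)
    fix k
    \<comment> \<open>Transposing reverses products, so the two terms of the bracket trade places;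
      the sign \<open>e\<close> in \<open>u * v = e * c\<close> passes from one to the other since
      \<open>e * e = 1\<close>.\<close>
    have expand: "- c * (a * b - e * (a' * b')) = - u * b' * (- v * a') - e * (- u * b * (- v * a))"
      if "e * e = 1" "u * v = e * c" for a b a' b' c e u v :: complex
      using that by algebra
    show "- ?c r s * (cnj (Y $ swap_L s $ swap_L k) * cnj (Z $ swap_L k $ swap_L r)
        - ?e k * (cnj (Z $ swap_L s $ swap_L k) * cnj (Y $ swap_L k $ swap_L r))) =
      - ?c r k * cnj (Y $ swap_L k $ swap_L r) * (- ?c k s * cnj (Z $ swap_L s $ swap_L k))
      - ?e k * (- ?c r k * cnj (Z $ swap_L k $ swap_L r) * (- ?c k s * cnj (Y $ swap_L s $ swap_L k)))"
      by (rule expand[OF _ c]) simp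
  qed simp
  finally show "xi_Lie j (superbracket Y Z) $ r $ s = superbracket (xi_Lie j Y) (xi_Lie j Z) $ r $ s" .
qed

lemma Lie_conjugation_xi_Lie:
  assumes "j \<in> {\<i>, - \<i>}"
  shows "Lie_conjugation (xi_Lie j)"
proof -
  \<comment> \<open>Applying \<open>xi_Lie j\<close> twice multiplies odd entries by
    \<open>j * cnj j\<close>, hence involutivity.\<close>
  have j: "j * j = - 1" "j * cnj j = 1" "j * (cnj j * z) = z" for z using assms by auto
  show ?thesis
    unfolding Lie_conjugation_def
    by (auto simp: xi_Lie_superbracket[OF j(1)])
      (auto simp: vec_eq_iff xi_Lie_nth Lie_even_nth Lie_odd_nth algebra_simps j(2,3))
qed

lemma sigma_conj_eq_xi_Lie: "sigma_conj = xi_Lie (- \<i>)"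
  by (simp add: fun_eq_iff sigma_conj_def xi_Lie_def)

lemma xi_induces_xi_Lie:
  assumes "j \<in> {\<i>, - \<i>}"
  shows "induces_on_Lie (xi cnj_sdual j) (xi_Lie j)"
  unfolding induces_on_Lie_def
proof
  fix Y
  \<comment> \<open>Stated for every \<open>Y\<close>: the instance at \<open>- Y\<close> gives the
    inverse on the other side.\<close>
  have inv: "(mat 1 + eps Y) ** (mat 1 + eps (- Y)) = mat 1" for Y
  proof -
    have neg: "eps (- Y) = - eps Y"
      by (simp add: vec_eq_iff eps_nth sdual_defs)
    show ?thesis
      \<comment> \<open>\<open>neg\<close> is held back until \<open>eps_mult_eps\<close> has
        removed \<open>eps Y ** eps (- Y)\<close>.\<close>
      by (simp add: matrix_add_ldistrib matrix_add_rdistrib' eps_mult_eps) (simp add: neg)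
  qed
  have "xi cnj_sdual j (mat 1 + eps Y) = L ** theta cnj_sdual j (mat 1 + eps (- Y)) ** L"
    using xi_eq(1)[OF conjugate_superalgebra_sdual assms id_plus_eps_GL41 inv] inv[of "- Y"] by simp
  also have "\<dots> = mat 1 + eps (xi_Lie j Y)"
    by (auto simp: vec_eq_iff L_mult_nth mult_L_nth theta_nth xi_Lie_nth eps_nth mat_def cnj_sdual_def sdual_defs)
  finally show "xi cnj_sdual j (mat 1 + eps Y) = mat 1 + eps (xi_Lie j Y)" .
qed

theorem proposition5p4:
  fixes j :: complex
  assumes "j \<in> {\<i>, - \<i>}"
  shows "induces_on_Lie (xi cnj_sdual j) (xi_Lie j) \<and> Lie_conjugation (xi_Lie j) \<and>
    Lie_conjugation sigma_conj \<and> (j = - \<i> \<longrightarrow> xi_Lie j = sigma_conj)"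
  using xi_induces_xi_Lie[OF assms] Lie_conjugation_xi_Lie[OF assms]
    Lie_conjugation_xi_Lie[of "- \<i>"] by (simp add: sigma_conj_eq_xi_Lie)

end
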